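(* Suppose that each of the functions $C_t$ is convex and that each of the functions $A_t$ is convex ($t=1,\dots,T$). Then, for each $t=1,\dots,T$: (i) the function $V_{t-1}$ is convex; (ii) $\hat x_t(s_{t-1})$ is a decreasing (i.e. nonincreasing) function of $s_{t-1}$; (iii) $s_{t-1}+\hat x_t(s_{t-1})$ is an increasing (i.e. nondecreasing) function of $s_{t-1}$.
   Context: Time periods are $t=1,\dots,T$. A store has capacity $E_t>0$ in period $t$, and input and output rate limits $P_{It},P_{Ot}\ge 0$; put $X_t=\{x\in\mathbb{R}:-P_{Ot}\le x\le P_{It}\}$. The cost of a planned change $x\in X_t$ of the store level in period $t$ is $C_t(x)$, a real-valued function on $X_t$. For each $t$, $A_t$ is a given real-valued function of the planned level at the end of period $t$ (the expected additional cost of dealing with random shocks). The functions $V_t$ (minimal expected future cost from the end of period $t$) are defined by $V_T(s)=0$ for all possible levels $s$, and, for $t=T,\dots,1$, $$V_{t-1}(s_{t-1})=\min_{x_t\in X_t,\ s_{t-1}+x_t\in[0,E_t]}\bigl[C_t(x_t)+A_t(s_{t-1}+x_t)+V_t(s_{t-1}+x_t)\bigr].$$ Levels are nonnegative reals. $V_{t-1}(s_{t-1})=+\infty$ if there is no feasible $x_t$, convexity is understood for extended-valued functions, and statements (ii), (iii) refer to levels $s_{t-1}$ with $V_{t-1}(s_{t-1})<\infty$. The displayed minima are assumed to be attained. $\hat x_t(s_{t-1})$ denotes the value of $x_t$ achieving the minimum in the recursion; in case of nonuniqueness, (ii) and (iii) mean that the minimisers $\hat x_t(s_{t-1})$ may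 be chosen so that these monotonicity properties hold. *)

theory Defs
  imports "HOL-Analysis.Analysis"
begin

definition rate_set :: "(nat \<Rightarrow> real) \<Rightarrow> (nat \<Rightarrow> real) \<Rightarrow> nat \<Rightarrow> real set" where
  "rate_set P_I P_O t = {- P_O t .. P_I t}"

definition feasible ::
  "(nat \<Rightarrow> real) \<Rightarrow> (nat \<Rightarrow> real) \<Rightarrow> (nat \<Rightarrow> real) \<Rightarrow> nat \<Rightarrow> real \<Rightarrow> real set" where
  "feasible E P_I P_O t s = {x \<in> rate_set P_I P_O t. s + x \<in> {0 .. E t}}"

text \<open>The infimum over an empty feasible set is \<open>\<infinity>\<close> in type \<^typ>\<open>ereal\<close>. The terminal
  condition is extended by \<open>0\<close> to all indices from \<open>T\<close> on, which makes the function total.\<close>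

function future_cost ::
  "nat \<Rightarrow> (nat \<Rightarrow> real) \<Rightarrow> (nat \<Rightarrow> real) \<Rightarrow> (nat \<Rightarrow> real) \<Rightarrow> (nat \<Rightarrow> real \<Rightarrow> real) \<Rightarrow>
    (nat \<Rightarrow> real \<Rightarrow> real) \<Rightarrow> nat \<Rightarrow> real \<Rightarrow> ereal" where
  "future_cost T E P_I P_O C A t s =
    (if t < T
     then INF x \<in> feasible E P_I P_O (Suc t) s.
       ereal (C (Suc t) x) + ereal (A (Suc t) (s + x)) +
       future_cost T E P_I P_O C A (Suc t) (s + x)
     else 0)"
  by pat_completeness auto
termination
  by (relation "Wellfounded.measure (\<lambda>(T, E, P_I, P_O, C, A, t, s). T - t)") auto

declare future_cost.simps [simp del]

definition period_cost ::
  "nat \<Rightarrow> (nat \<Rightarrow> real) \<Rightarrow> (nat \<Rightarrow> real) \<Rightarrow> (nat \<Rightarrow> real) \<Rightarrow> (nat \<Rightarrow> real \<Rightarrow> real) \<Rightarrow>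
    (nat \<Rightarrow> real \<Rightarrow> real) \<Rightarrow> nat \<Rightarrow> real \<Rightarrow> real \<Rightarrow> ereal" where
  "period_cost T E P_I P_O C A t s x =
    ereal (C t x) + ereal (A t (s + x)) + future_cost T E P_I P_O C A t (s + x)"

definition is_minimiser ::
  "nat \<Rightarrow> (nat \<Rightarrow> real) \<Rightarrow> (nat \<Rightarrow> real) \<Rightarrow> (nat \<Rightarrow> real) \<Rightarrow> (nat \<Rightarrow> real \<Rightarrow> real) \<Rightarrow>
    (nat \<Rightarrow> real \<Rightarrow> real) \<Rightarrow> nat \<Rightarrow> real \<Rightarrow> real \<Rightarrow> bool" where
  "is_minimiser T E P_I P_O C A t s x \<longleftrightarrow>
    is_arg_min (period_cost T E P_I P_O C A t s) (\<lambda>y. y \<in> feasible E P_I P_O t s) x"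

definition finite_levels ::
  "nat \<Rightarrow> (nat \<Rightarrow> real) \<Rightarrow> (nat \<Rightarrow> real) \<Rightarrow> (nat \<Rightarrow> real) \<Rightarrow> (nat \<Rightarrow> real \<Rightarrow> real) \<Rightarrow>
    (nat \<Rightarrow> real \<Rightarrow> real) \<Rightarrow> nat \<Rightarrow> real set" where
  "finite_levels T E P_I P_O C A t = {s. 0 \<le> s \<and> future_cost T E P_I P_O C A t s < \<infinity>}"

text \<open>The library predicate \<^const>\<open>convex_on\<close> covers real-valued functions only. In type
  \<^typ>\<open>ereal\<close>, \<open>0 * \<infinity> = 0\<close>, so the inequality is trivial when \<open>u\<close> or \<open>v\<close> vanishes.\<close>

definition ereal_convex_on :: "real set \<Rightarrow> (real \<Rightarrow> ereal) \<Rightarrow> bool" where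
  "ereal_convex_on S f \<longleftrightarrow> convex S \<and>
    (\<forall>x\<in>S. \<forall>y\<in>S. \<forall>u v. 0 \<le> u \<longrightarrow> 0 \<le> v \<longrightarrow> u + v = 1 \<longrightarrow>
      f (u * x + v * y) \<le> ereal u * f x + ereal v * f y)"

end

theory Submission
  imports Defs
begin

text \<open>
  Put \<open>b = A\<^sub>t + V\<^sub>t\<close> on the convex set of levels where \<open>V\<^sub>t\<close> is finite. Period \<open>t\<close> then asks for
  the minimum over \<open>x\<close> of \<open>C\<^sub>t x + b (s + x)\<close>, which is jointly convex in \<open>(s, x)\<close>; minimising
  out \<open>x\<close> leaves a convex function of \<open>s\<close>, and backward induction gives convexity of every
  \<open>V\<^sub>t\<close> (\<open>one_period.min_cost_convex\<close>). The same induction has to carry \<open>V\<^sub>t \<noteq> -\<infinity>\<close>, which holds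
  because the minima are attained.

  Monotonicity of the minimisers is an exchange argument. Let \<open>s \<le> s'\<close> and let \<open>x < x'\<close> be
  minimisers at \<open>s\<close> and at \<open>s'\<close> respectively. Swapping them does not change the \<open>C\<^sub>t\<close>-part of the
  total cost of the two problems, and replaces the levels \<open>s + x\<close> and \<open>s' + x'\<close> by two levels
  that lie between them and have the same sum, so convexity of \<open>b\<close> makes the total no larger.
  Hence both swapped decisions are optimal too (\<open>minimisers_exchange\<close>), and the infimum and
  supremum of the set of minimisers are nonincreasing in \<open>s\<close>.

  Convex functions may jump at the ends of their domains, so the set of minimisers need not be
  closed and its endpoints need not be minimisers. It is, however, a bounded convex subset of
  the line, so it contains the midpoint of its infimum and supremum, and this midpoint is the
  selection (\<open>midpoint_in_set\<close>, \<open>midpoint_minimisers_antimono\<close>).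

  Written in terms of the new level \<open>y = s + x\<close>, the cost is \<open>b y + C\<^sub>t (-s + y)\<close>: the same
  problem with \<open>C\<^sub>t\<close> and \<open>b\<close> interchanged and \<open>s\<close> replaced by \<open>-s\<close>. So the nondecreasing
  dependence of \<open>s + x\<close> on \<open>s\<close> is the first monotonicity statement for the interchanged problem
  (\<open>minimisers_swap\<close>).
\<close>

section \<open>Minimising a sum of two convex functions of a shifted argument\<close>

definition minimisers ::
  "real set \<Rightarrow> real set \<Rightarrow> (real \<Rightarrow> real) \<Rightarrow> (real \<Rightarrow> real) \<Rightarrow> real \<Rightarrow> real set" where
  "minimisers X Y c b s =
    {x \<in> X. s + x \<in> Y \<and> (\<forall>z\<in>X. s + z \<in> Y \<longrightarrow> c x + b (s + x) \<le> c z + b (s + z))}"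

lemma minimisers_le:
  assumes "x \<in> minimisers X Y c b s" "z \<in> X" "s + z \<in> Y"
  shows "c x + b (s + x) \<le> c z + b (s + z)"
  using assms by (auto simp: minimisers_def)

text \<open>The interchange of the two summands corresponds to taking the new level \<open>y = s + x\<close>, instead
  of the change \<open>x\<close>, as the decision variable: then \<open>x = -s + y\<close>.\<close>

lemma minimisers_swap: "minimisers Y X b c (- s) = (+) s ` minimisers X Y c b s"
proof (intro set_eqI iffI)
  fix y assume y: "y \<in> minimisers Y X b c (- s)"
  have "y - s \<in> minimisers X Y c b s"
    unfolding minimisers_def
  proof (intro CollectI conjI ballI impI)
    show "y - s \<in> X" "s + (y - s) \<in> Y"
      using y by (auto simp: minimisers_def)
    fix z assume "z \<in> X" "s + z \<in> Y"
    then show "c (y - s) + b (s + (y - s)) \<le> c z + b (s + z)"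
      using minimisers_le[OF y, of "s + z"] by simp
  qed
  then show "y \<in> (+) s ` minimisers X Y c b s"
    by (intro image_eqI[of _ _ "y - s"]) auto
next
  fix y assume "y \<in> (+) s ` minimisers X Y c b s"
  then obtain x where y: "y = s + x" and x: "x \<in> minimisers X Y c b s"
    by auto
  show "y \<in> minimisers Y X b c (- s)"
    unfolding minimisers_def
  proof (intro CollectI conjI ballI impI)
    show "y \<in> Y" "- s + y \<in> X"
      using x by (auto simp: minimisers_def y)
    fix z assume "z \<in> Y" "- s + z \<in> X"
    then show "b y + c (- s + y) \<le> b z + c (- s + z)"
      using minimisers_le[OF x, of "- s + z"] by (simp add: y)
  qed
qed

text \<open>Write \<open>r\<close> as a convex combination of \<open>p\<close> and \<open>q\<close>; then \<open>r'\<close> is the combination with the two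
  weights interchanged, and the two convexity inequalities add up.\<close>

lemma convex_on_four_points:
  fixes f :: "real \<Rightarrow> real"
  assumes f: "convex_on S f" and S: "p \<in> S" "q \<in> S"
    and r: "p \<le> r" "r \<le> q" and sum: "r + r' = p + q"
  shows "f r + f r' \<le> f p + f q"
proof (cases "p = q")
  case True
  then show ?thesis using r sum by auto
next
  case False
  then have pq: "p < q" using r by simp
  define l where "l = (r - p) / (q - p)"
  have l: "0 \<le> l" "l \<le> 1" using pq r by (auto simp: l_def)
  have "l * (q - p) = r - p" using pq by (simp add: l_def)
  then have eqs: "r = (1 - l) * p + l * q" "r' = l * p + (1 - l) * q"
    using sum by (auto simp: algebra_simps)
  have "f r \<le> (1 - l) * f p + l * f q"
    using convex_onD[OF f, of l p q] l S by (simp add: eqs)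
  moreover have "f r' \<le> l * f p + (1 - l) * f q"
    using convex_onD[OF f, of "1 - l" p q] l S by (simp add: eqs)
  ultimately show ?thesis by (simp add: algebra_simps)
qed

lemma shifted_sum_convex:
  fixes c b :: "real \<Rightarrow> real"
  assumes c: "convex_on X c" and b: "convex_on Y b"
    and x: "x \<in> X" "x' \<in> X" and y: "s + x \<in> Y" "s' + x' \<in> Y"
    and uv: "0 \<le> u" "0 \<le> v" "u + v = 1"
  defines "z \<equiv> u * x + v * x'" and "r \<equiv> u * s + v * s'"
  shows "z \<in> X" "r + z \<in> Y"
    "c z + b (r + z) \<le> u * (c x + b (s + x)) + v * (c x' + b (s' + x'))"
proof -
  have rz: "r + z = u * (s + x) + v * (s' + x')"
    by (simp add: z_def r_def algebra_simps)
  show "z \<in> X"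
    using convexD[OF convex_on_imp_convex[OF c] x uv] by (simp add: z_def)
  show "r + z \<in> Y"
    using convexD[OF convex_on_imp_convex[OF b] y uv] by (simp add: rz)
  have "c z \<le> u * c x + v * c x'"
    using c x uv by (simp add: convex_on_def z_def)
  moreover have "b (r + z) \<le> u * b (s + x) + v * b (s' + x')"
    unfolding rz using b y uv by (simp add: convex_on_def)
  ultimately show "c z + b (r + z) \<le> u * (c x + b (s + x)) + v * (c x' + b (s' + x'))"
    by (simp add: algebra_simps)
qed

lemma convex_minimisers:
  assumes c: "convex_on X c" and b: "convex_on Y b"
  shows "convex (minimisers X Y c b s)"
proof (rule convexI)
  fix x x' u v :: real
  assume x: "x \<in> minimisers X Y c b s" and x': "x' \<in> minimisers X Y c b s"
    and uv: "0 \<le> u" "0 \<le> v" "u + v = 1"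
  define w where "w = u * x + v * x'"
  have s: "u * s + v * s = s"
    using uv by (simp flip: distrib_right)
  have X: "x \<in> X" "x' \<in> X" and Y: "s + x \<in> Y" "s + x' \<in> Y"
    using x x' by (auto simp: minimisers_def)
  note w = shifted_sum_convex[OF c b X Y uv, unfolded s, folded w_def]
  have "w \<in> minimisers X Y c b s"
    unfolding minimisers_def
  proof (intro CollectI conjI ballI impI w(1,2))
    fix z assume z: "z \<in> X" "s + z \<in> Y"
    have "c w + b (s + w) \<le> u * (c x + b (s + x)) + v * (c x' + b (s + x'))"
      by (rule w(3))
    also have "\<dots> \<le> u * (c z + b (s + z)) + v * (c z + b (s + z))"
      using minimisers_le[OF x z] minimisers_le[OF x' z] uv
      by (intro add_mono[of "u * _" _ "v * _"] mult_left_mono)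
    also have "\<dots> = c z + b (s + z)"
      using uv by (simp flip: distrib_right)
    finally show "c w + b (s + w) \<le> c z + b (s + z)" .
  qed
  then show "u *\<^sub>R x + v *\<^sub>R x' \<in> minimisers X Y c b s"
    by (simp add: w_def)
qed

text \<open>Each of the two optimal costs bounds one of the two swapped costs from below, while the
  swapped costs have in total at most the optimal total; so both bounds are equalities.\<close>

lemma minimisers_exchange:
  assumes b: "convex_on Y b"
    and s: "s \<le> s'"
    and x: "x \<in> minimisers X Y c b s" and x': "x' \<in> minimisers X Y c b s'"
    and less: "x < x'"
  shows "x' \<in> minimisers X Y c b s" and "x \<in> minimisers X Y c b s'"
proof -
  have X: "x \<in> X" "x' \<in> X" and Y: "s + x \<in> Y" "s' + x' \<in> Y"
    using x x' by (auto simp: minimisers_def)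
  have "is_interval Y"
    using convex_on_imp_convex[OF b] by (simp add: is_interval_convex_1)
  note between = mem_is_interval_1_I[OF this Y]
  have Y': "s + x' \<in> Y" "s' + x \<in> Y"
    by (intro between; use s less in simp)+
  have four: "b (s + x') + b (s' + x) \<le> b (s + x) + b (s' + x')"
    by (rule convex_on_four_points[OF b Y]) (use s less in auto)
  have opt: "c x + b (s + x) \<le> c x' + b (s + x')" "c x' + b (s' + x') \<le> c x + b (s' + x)"
    using minimisers_le[OF x X(2) Y'(1)] minimisers_le[OF x' X(1) Y'(2)] by auto
  have le: "c x' + b (s + x') \<le> c x + b (s + x)" "c x + b (s' + x) \<le> c x' + b (s' + x')"
    using four opt by auto
  show "x' \<in> minimisers X Y c b s"
    unfolding minimisers_def using X Y' minimisers_le[OF x] le(1)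
    by (auto intro: order_trans)
  show "x \<in> minimisers X Y c b s'"
    unfolding minimisers_def using X Y' minimisers_le[OF x'] le(2)
    by (auto intro: order_trans)
qed

section \<open>A monotone selection of minimisers\<close>

definition inf_sup_midpoint :: "real set \<Rightarrow> real" where
  "inf_sup_midpoint M = (Inf M + Sup M) / 2"

text \<open>If the infimum and the supremum differ, the midpoint lies strictly between two elements of
  the set, even when neither endpoint belongs to it.\<close>

lemma midpoint_in_set:
  assumes "convex M" "bounded M" "M \<noteq> {}"
  shows "inf_sup_midpoint M \<in> M"
proof -
  have bdd: "bdd_below M" "bdd_above M"
    using assms(2) by (auto intro: bounded_imp_bdd_below bounded_imp_bdd_above)
  have le: "Inf M \<le> Sup M"
    using bdd assms(3) by (simp add: cInf_le_cSup)
  show ?thesis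
  proof (cases "Inf M = Sup M")
    case True
    obtain x where x: "x \<in> M" using assms(3) by auto
    then have "Inf M \<le> x" "x \<le> Sup M"
      using bdd by (auto intro: cInf_lower cSup_upper)
    then have "inf_sup_midpoint M = x"
      using True by (simp add: inf_sup_midpoint_def)
    then show ?thesis using x by simp
  next
    case False
    then have "Inf M < inf_sup_midpoint M" "inf_sup_midpoint M < Sup M"
      using le by (auto simp: inf_sup_midpoint_def)
    then obtain x y where "x \<in> M" "x < inf_sup_midpoint M" "y \<in> M" "inf_sup_midpoint M < y"
      using cInf_less_iff[OF assms(3) bdd(1)] less_cSup_iff[OF assms(3) bdd(2)] by blast
    moreover have "is_interval M"
      using assms(1) by (simp add: is_interval_convex_1)
    ultimately show ?thesis
      by (meson less_imp_le mem_is_interval_1_I)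
  qed
qed

lemma inf_sup_midpoint_translate:
  assumes "bounded M" "M \<noteq> {}"
  shows "inf_sup_midpoint ((+) s ` M) = s + inf_sup_midpoint M"
proof -
  have bdd: "bdd_below M" "bdd_above M"
    using assms(1) by (auto intro: bounded_imp_bdd_below bounded_imp_bdd_above)
  have cont: "continuous (at z within B) (\<lambda>x. s + x)" for z B
    by (intro continuous_intros)
  have "Inf ((+) s ` M) = s + Inf M"
    using continuous_at_Inf_mono[OF _ cont assms(2) bdd(1)] by (simp add: mono_def)
  moreover have "Sup ((+) s ` M) = s + Sup M"
    using continuous_at_Sup_mono[OF _ cont assms(2) bdd(2)] by (simp add: mono_def)
  ultimately show ?thesis
    by (simp add: inf_sup_midpoint_def field_simps)
qed

text \<open>By the exchange property the smaller of a minimiser at \<open>s\<close> and one at \<open>s'\<close> is a minimiser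
  at the larger shift \<open>s'\<close>, and the larger of them is a minimiser at \<open>s\<close>; this compares the
  infima and the suprema.\<close>

lemma midpoint_minimisers_antimono:
  assumes b: "convex_on Y b" and s: "s \<le> s'"
    and M: "M = minimisers X Y c b s" "bounded M" "M \<noteq> {}"
    and M': "M' = minimisers X Y c b s'" "bounded M'" "M' \<noteq> {}"
  shows "inf_sup_midpoint M' \<le> inf_sup_midpoint M"
proof -
  note exchange = minimisers_exchange[OF b s, of _ X c, folded M(1) M'(1)]
  obtain m m' where m: "m \<in> M" "m' \<in> M'"
    using M(3) M'(3) by auto
  have "Inf M' \<le> Inf M"
  proof (rule cInf_mono[OF M(3) bounded_imp_bdd_below[OF M'(2)]])
    fix x assume "x \<in> M"
    then show "\<exists>x'\<in>M'. x' \<le> x"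
      using exchange(2)[of x m'] m by (cases "x < m'") (auto simp: not_less)
  qed
  moreover have "Sup M' \<le> Sup M"
  proof (rule cSup_mono[OF M'(3) bounded_imp_bdd_above[OF M(2)]])
    fix x' assume "x' \<in> M'"
    then show "\<exists>x\<in>M. x' \<le> x"
      using exchange(1)[of m x'] m by (cases "m < x'") (auto simp: not_less)
  qed
  ultimately show ?thesis
    by (simp add: inf_sup_midpoint_def)
qed

lemma exists_monotone_minimisers:
  assumes c: "convex_on X c" and b: "convex_on Y b" and X: "bounded X"
    and ne: "\<And>s. s \<in> S \<Longrightarrow> minimisers X Y c b s \<noteq> {}"
  shows "\<exists>g. (\<forall>s\<in>S. g s \<in> minimisers X Y c b s) \<and> antimono_on S g \<and> mono_on S (\<lambda>s. s + g s)"
proof (intro exI conjI ballI)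
  let ?M = "minimisers X Y c b"
  define g where "g s = inf_sup_midpoint (?M s)" for s
  have bdd: "bounded (?M s)" for s
    by (rule bounded_subset[OF X]) (auto simp: minimisers_def)
  show "g s \<in> ?M s" if "s \<in> S" for s
    unfolding g_def by (rule midpoint_in_set[OF convex_minimisers[OF c b] bdd ne[OF that]])
  show "antimono_on S g"
    unfolding g_def
    by (intro monotone_onI midpoint_minimisers_antimono[OF b _ refl bdd _ refl bdd] ne)
  show "mono_on S (\<lambda>s. s + g s)"
  proof (rule mono_onI)
    fix r s assume rs: "r \<in> S" "s \<in> S" "r \<le> s"
    \<comment> \<open>in the interchanged problem the shifts are \<open>-s \<le> -r\<close>, so the order is reversed twice\<close>
    have g: "s + g s = inf_sup_midpoint (minimisers Y X b c (- s))" if "s \<in> S" for s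
      unfolding minimisers_swap g_def using inf_sup_midpoint_translate[OF bdd ne[OF that]] by simp
    have swap: "bounded (minimisers Y X b c (- s))" "minimisers Y X b c (- s) \<noteq> {}"
      if "s \<in> S" for s
      using bounded_translation[OF bdd, of s] ne[OF that] by (auto simp: minimisers_swap)
    show "r + g r \<le> s + g s"
      unfolding g[OF rs(1)] g[OF rs(2)]
      by (rule midpoint_minimisers_antimono[OF c _ refl swap refl swap]) (use rs in auto)
  qed
qed

section \<open>One period of the recursion\<close>

text \<open>\<open>X\<close> and \<open>Y\<close> are the admissible changes and new levels, \<open>c\<close> and \<open>a\<close> the two costs of the
  period, and \<open>W\<close> is the future cost seen from its end. Excluding the value \<open>-\<infinity>\<close> makes \<open>W\<close> a
  real-valued convex function on the set \<open>D\<close> of levels where it is below \<open>\<infinity>\<close>.\<close>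

locale one_period =
  fixes X Y :: "real set" and c a :: "real \<Rightarrow> real" and W :: "real \<Rightarrow> ereal"
  assumes convex_c: "convex_on X c" and convex_a: "convex_on Y a"
    and convex_W: "ereal_convex_on Y W"
    and W_not_MInfty: "\<And>y. y \<in> Y \<Longrightarrow> W y \<noteq> - \<infinity>"
begin

definition cost :: "real \<Rightarrow> real \<Rightarrow> ereal" where
  "cost s x = ereal (c x) + ereal (a (s + x)) + W (s + x)"

definition optimum :: "real \<Rightarrow> real \<Rightarrow> bool" where
  "optimum s = is_arg_min (cost s) (\<lambda>x. x \<in> {x \<in> X. s + x \<in> Y})"

definition min_cost :: "real \<Rightarrow> ereal" where
  "min_cost s = (INF x \<in> {x \<in> X. s + x \<in> Y}. cost s x)"

definition D :: "real set" where
  "D = {y \<in> Y. W y < \<infinity>}"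

definition b :: "real \<Rightarrow> real" where
  "b y = a y + real_of_ereal (W y)"

lemma W_finite: "y \<in> D \<Longrightarrow> W y = ereal (real_of_ereal (W y))"
  using W_not_MInfty[of y] by (cases "W y") (auto simp: D_def)

lemma cost_finite: "s + x \<in> D \<Longrightarrow> cost s x = ereal (c x + b (s + x))"
  by (subst cost_def, subst W_finite) (auto simp: b_def)

lemma cost_infinite: "s + x \<in> Y \<Longrightarrow> s + x \<notin> D \<Longrightarrow> cost s x = \<infinity>"
  by (auto simp: cost_def D_def)

lemma cost_not_MInfty: "s + x \<in> Y \<Longrightarrow> cost s x \<noteq> - \<infinity>"
  using cost_finite cost_infinite by (cases "s + x \<in> D") auto

lemma W_convex_finite:
  assumes xy: "x \<in> D" "y \<in> D" and uv: "0 \<le> u" "0 \<le> v" "u + v = 1"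
  shows "u * x + v * y \<in> D"
    and "real_of_ereal (W (u * x + v * y)) \<le> u * real_of_ereal (W x) + v * real_of_ereal (W y)"
proof -
  let ?w = "\<lambda>y. real_of_ereal (W y)"
  have Y: "x \<in> Y" "y \<in> Y" using xy by (auto simp: D_def)
  have Yz: "u * x + v * y \<in> Y"
    using convex_W convexD[of Y x y u v] Y uv by (auto simp: ereal_convex_on_def)
  have "W (u * x + v * y) \<le> ereal u * W x + ereal v * W y"
    using convex_W Y uv by (auto simp: ereal_convex_on_def)
  also have "\<dots> = ereal (u * ?w x + v * ?w y)"
    by (subst W_finite[OF xy(1)], subst W_finite[OF xy(2)]) simp
  finally have le: "W (u * x + v * y) \<le> ereal (u * ?w x + v * ?w y)" .
  then show D: "u * x + v * y \<in> D"
    using Yz by (auto simp: D_def)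
  show "?w (u * x + v * y) \<le> u * ?w x + v * ?w y"
    using le by (subst (asm) W_finite[OF D]) simp
qed

lemma convex_b: "convex_on D b"
proof -
  have D: "convex D"
    using W_convex_finite(1) by (auto intro: convexI)
  have "convex_on D a"
    by (rule convex_on_subset[OF convex_a _ D]) (auto simp: D_def)
  moreover have "convex_on D (\<lambda>y. real_of_ereal (W y))"
    using D W_convex_finite(2) by (auto simp: convex_on_def)
  ultimately show ?thesis
    unfolding b_def by (rule convex_on_add)
qed

lemma min_cost_eq_cost: "optimum s x \<Longrightarrow> min_cost s = cost s x"
  unfolding min_cost_def optimum_def is_arg_min_def
  by (intro antisym INF_greatest INF_lower) (auto simp: not_less)

text \<open>Where the minimal cost is finite, decisions leading to levels outside \<open>D\<close> cost \<open>\<infinity>\<close> and cannot be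
  optimal, so the extended-valued problem is the real-valued one on \<open>D\<close>.\<close>

lemma optimum_iff_minimisers:
  assumes fin: "min_cost s < \<infinity>"
  shows "optimum s x \<longleftrightarrow> x \<in> minimisers X D c b s"
proof
  assume opt: "optimum s x"
  have x: "x \<in> X" "s + x \<in> Y"
    using opt by (auto simp: optimum_def is_arg_min_def)
  have D: "s + x \<in> D"
    using fin cost_infinite[OF x(2)] min_cost_eq_cost[OF opt] by auto
  show "x \<in> minimisers X D c b s"
    unfolding minimisers_def
  proof (intro CollectI conjI ballI impI x D)
    fix z assume z: "z \<in> X" "s + z \<in> D"
    then have "cost s x \<le> cost s z"
      using opt by (auto simp: optimum_def is_arg_min_def D_def not_less)
    then show "c x + b (s + x) \<le> c z + b (s + z)"
      using cost_finite[OF D] cost_finite[OF z(2)] by simp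
  qed
next
  assume x: "x \<in> minimisers X D c b s"
  have D: "s + x \<in> D" using x by (simp add: minimisers_def)
  have "cost s x \<le> cost s z" if z: "z \<in> X" "s + z \<in> Y" for z
    using minimisers_le[OF x z(1)] cost_finite[OF D] cost_finite[of s z]
      cost_infinite[OF z(2)]
    by (cases "s + z \<in> D") auto
  then show "optimum s x"
    using x by (auto simp: optimum_def is_arg_min_def minimisers_def D_def not_less)
qed

context
  fixes S :: "real set"
  assumes attained: "\<And>s. s \<in> S \<Longrightarrow> {x \<in> X. s + x \<in> Y} \<noteq> {} \<Longrightarrow> \<exists>x. optimum s x"
begin

lemma finite_min_cost_optimum:
  assumes "s \<in> S" "min_cost s < \<infinity>"
  obtains x where "optimum s x"
proof -
  have "{x \<in> X. s + x \<in> Y} \<noteq> {}"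
  proof
    assume "{x \<in> X. s + x \<in> Y} = {}"
    then have "min_cost s = \<infinity>"
      unfolding min_cost_def by (simp only: INF_empty) (simp add: top_ereal_def)
    then show False using assms(2) by simp
  qed
  then show thesis using attained[OF assms(1)] that by blast
qed

lemma min_cost_not_MInfty:
  assumes "s \<in> S"
  shows "min_cost s \<noteq> - \<infinity>"
proof
  assume inf: "min_cost s = - \<infinity>"
  then obtain x where opt: "optimum s x"
    using finite_min_cost_optimum[OF assms] by auto
  then have "s + x \<in> Y"
    by (simp add: optimum_def is_arg_min_def)
  then show False
    using inf cost_not_MInfty min_cost_eq_cost[OF opt] by simp
qed

text \<open>A zero weight is trivial. If both weights are positive and one of the two values is \<open>\<infinity>\<close>,
  then so is the right-hand side, as the other value is not \<open>-\<infinity>\<close>. Otherwise the convex combination of two optimal decisions is feasible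
  for the combined level and costs no more than the combination of the two minima.\<close>

lemma min_cost_convex:
  assumes S: "convex S"
  shows "ereal_convex_on S min_cost"
  unfolding ereal_convex_on_def
proof (intro conjI S ballI allI impI)
  fix s s' u v :: real
  assume s: "s \<in> S" "s' \<in> S" and uv: "0 \<le> u" "0 \<le> v" "u + v = 1"
  show "min_cost (u * s + v * s') \<le> ereal u * min_cost s + ereal v * min_cost s'"
  proof (cases "u = 0 \<or> v = 0 \<or> min_cost s = \<infinity> \<or> min_cost s' = \<infinity>")
    case True
    then consider "u = 0" | "v = 0" | "0 < u" "0 < v" "min_cost s = \<infinity> \<or> min_cost s' = \<infinity>"
      using uv by fastforce
    then show ?thesis
    proof cases
      case 3
      then have "ereal u * min_cost s + ereal v * min_cost s' = \<infinity>"
        using min_cost_not_MInfty[OF s(1)] min_cost_not_MInfty[OF s(2)]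
        by (cases "min_cost s"; cases "min_cost s'") auto
      then show ?thesis by (simp only: ereal_less_eq)
    qed (use uv in \<open>auto simp: zero_ereal_def[symmetric] one_ereal_def[symmetric]\<close>)
  next
    case False
    then have fin: "min_cost s < \<infinity>" "min_cost s' < \<infinity>" by auto
    obtain x x' where opt: "optimum s x" "optimum s' x'"
      using finite_min_cost_optimum s fin by metis
    then have "x \<in> minimisers X D c b s" "x' \<in> minimisers X D c b s'"
      using optimum_iff_minimisers fin by auto
    then have X: "x \<in> X" "x' \<in> X" and D: "s + x \<in> D" "s' + x' \<in> D"
      by (auto simp: minimisers_def)
    define z where "z = u * x + v * x'"
    note z = shifted_sum_convex[OF convex_c convex_b X D uv, folded z_def]
    have "min_cost (u * s + v * s') \<le> cost (u * s + v * s') z"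
      unfolding min_cost_def by (rule INF_lower) (use z(1,2) in \<open>auto simp: D_def\<close>)
    also have "\<dots> \<le> ereal (u * (c x + b (s + x)) + v * (c x' + b (s' + x')))"
      using z(3) cost_finite[OF z(2)] by simp
    also have "\<dots> = ereal u * cost s x + ereal v * cost s' x'"
      by (simp add: cost_finite D)
    also have "\<dots> = ereal u * min_cost s + ereal v * min_cost s'"
      by (simp only: opt[THEN min_cost_eq_cost])
    finally show ?thesis .
  qed
qed

lemma exists_monotone_optima:
  assumes "bounded X" and fin: "\<And>s. s \<in> L \<Longrightarrow> s \<in> S \<and> min_cost s < \<infinity>"
  shows "\<exists>g. (\<forall>s\<in>L. optimum s (g s)) \<and> antimono_on L g \<and> mono_on L (\<lambda>s. s + g s)"
proof -
  have "minimisers X D c b s \<noteq> {}" if "s \<in> L" for s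
    using finite_min_cost_optimum[of s] optimum_iff_minimisers[of s] fin[OF that] by blast
  from exists_monotone_minimisers[OF convex_c convex_b assms(1) this]
  obtain g where g: "\<And>s. s \<in> L \<Longrightarrow> g s \<in> minimisers X D c b s"
      "antimono_on L g" "mono_on L (\<lambda>s. s + g s)"
    by blast
  have "optimum s (g s)" if "s \<in> L" for s
    using g(1)[OF that] optimum_iff_minimisers fin[OF that] by blast
  then show ?thesis using g(2,3) by blast
qed

end

end

section \<open>Backward induction\<close>

theorem proposition2:
  fixes T :: nat
    and E P_I P_O :: "nat \<Rightarrow> real"
    and C A :: "nat \<Rightarrow> real \<Rightarrow> real"
  assumes "\<And>t. t \<in> {1..T} \<Longrightarrow> E t > 0"
    and "\<And>t. t \<in> {1..T} \<Longrightarrow> P_I t \<ge> 0"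
    and "\<And>t. t \<in> {1..T} \<Longrightarrow> P_O t \<ge> 0"
    and "\<And>t s. t \<in> {1..T} \<Longrightarrow> s \<ge> 0 \<Longrightarrow> feasible E P_I P_O t s \<noteq> {} \<Longrightarrow>
          \<exists>x. is_minimiser T E P_I P_O C A t s x"
    and "\<And>t. t \<in> {1..T} \<Longrightarrow> convex_on (rate_set P_I P_O t) (C t)"
    and "\<And>t. t \<in> {1..T} \<Longrightarrow> convex_on {0 .. E t} (A t)"
  shows "\<forall>t\<in>{1..T}.
    ereal_convex_on {0..} (future_cost T E P_I P_O C A (t - 1)) \<and>
    (\<exists>x_hat :: real \<Rightarrow> real.
      (\<forall>s \<in> finite_levels T E P_I P_O C A (t - 1).
        is_minimiser T E P_I P_O C A t s (x_hat s)) \<and>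
      antimono_on (finite_levels T E P_I P_O C A (t - 1)) x_hat \<and>
      mono_on (finite_levels T E P_I P_O C A (t - 1)) (\<lambda>s. s + x_hat s))"
proof -
  let ?V = "future_cost T E P_I P_O C A"
  have period: "one_period (rate_set P_I P_O t) {0 .. E t} (C t) (A t) (?V t)"
    if t: "t \<in> {1..T}" and V: "ereal_convex_on {0..} (?V t)" "\<forall>s\<ge>0. ?V t s \<noteq> - \<infinity>" for t
  proof
    show "ereal_convex_on {0 .. E t} (?V t)"
      using V(1) by (auto simp: ereal_convex_on_def)
  qed (use assms(5,6) t V(2) in auto)
  have V_eq: "?V (t - 1) =
      one_period.min_cost (rate_set P_I P_O t) {0 .. E t} (C t) (A t) (?V t)"
    if t: "t \<in> {1..T}" and P: "one_period (rate_set P_I P_O t) {0 .. E t} (C t) (A t) (?V t)" for t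
  proof
    fix s
    show "?V (t - 1) s =
        one_period.min_cost (rate_set P_I P_O t) {0 .. E t} (C t) (A t) (?V t) s"
      by (subst future_cost.simps)
        (use t in \<open>auto simp: one_period.min_cost_def[OF P] one_period.cost_def[OF P] feasible_def\<close>)
  qed
  have optimum_eq: "one_period.optimum (rate_set P_I P_O t) {0 .. E t} (C t) (A t) (?V t) =
      is_minimiser T E P_I P_O C A t"
    if P: "one_period (rate_set P_I P_O t) {0 .. E t} (C t) (A t) (?V t)" for t
    by (intro ext) (simp add: one_period.optimum_def[OF P] one_period.cost_def[OF P, abs_def]
      is_minimiser_def period_cost_def[abs_def] feasible_def)
  have attained: "\<exists>x. one_period.optimum (rate_set P_I P_O t) {0 .. E t} (C t) (A t) (?V t) s x"
    if "t \<in> {1..T}" "one_period (rate_set P_I P_O t) {0 .. E t} (C t) (A t) (?V t)"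
      "s \<in> {0..}" "{x \<in> rate_set P_I P_O t. s + x \<in> {0 .. E t}} \<noteq> {}" for t s
    using assms(4)[of t s] that by (simp add: optimum_eq feasible_def)
  \<comment> \<open>the second conjunct makes \<open>?V t\<close> an admissible future cost for the preceding period\<close>
  have V: "ereal_convex_on {0..} (?V t) \<and> (\<forall>s\<ge>0. ?V t s \<noteq> - \<infinity>)" if "t \<le> T" for t
    using that
  proof (induction t rule: inc_induct)
    case base
    have "?V T = (\<lambda>_. 0)"
      by (intro ext, subst future_cost.simps) simp
    then show ?case by (simp add: ereal_convex_on_def)
  next
    case (step n)
    then have t: "Suc n \<in> {1..T}" by simp
    have P: "one_period (rate_set P_I P_O (Suc n)) {0 .. E (Suc n)} (C (Suc n)) (A (Suc n)) (?V (Suc n))"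
      using period[OF t] step.IH by blast
    have "?V n = one_period.min_cost (rate_set P_I P_O (Suc n)) {0 .. E (Suc n)}
        (C (Suc n)) (A (Suc n)) (?V (Suc n))"
      using V_eq[OF t P] by simp
    moreover have "ereal_convex_on {0..} \<dots>"
      by (rule one_period.min_cost_convex[OF P attained[OF t P]]) auto
    moreover have "one_period.min_cost (rate_set P_I P_O (Suc n)) {0 .. E (Suc n)}
        (C (Suc n)) (A (Suc n)) (?V (Suc n)) s \<noteq> - \<infinity>" if "0 \<le> s" for s
      by (rule one_period.min_cost_not_MInfty[OF P attained[OF t P], of "{0..}"]) (use that in auto)
    ultimately show ?case by simp
  qed
  show ?thesis
  proof (intro ballI conjI)
    fix t assume t: "t \<in> {1..T}"
    show "ereal_convex_on {0..} (?V (t - 1))"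
      using V[of "t - 1"] t by auto
    have P: "one_period (rate_set P_I P_O t) {0 .. E t} (C t) (A t) (?V t)"
      using period[OF t] V[of t] t by auto
    show "\<exists>x_hat. (\<forall>s\<in>finite_levels T E P_I P_O C A (t - 1).
          is_minimiser T E P_I P_O C A t s (x_hat s)) \<and>
        antimono_on (finite_levels T E P_I P_O C A (t - 1)) x_hat \<and>
        mono_on (finite_levels T E P_I P_O C A (t - 1)) (\<lambda>s. s + x_hat s)"
      unfolding optimum_eq[OF P, symmetric]
    proof (rule one_period.exists_monotone_optima[OF P attained[OF t P], of "{0..}"])
      show "bounded (rate_set P_I P_O t)"
        by (simp add: rate_set_def)
      show "s \<in> {0..} \<and>
          one_period.min_cost (rate_set P_I P_O t) {0 .. E t} (C t) (A t) (?V t) s < \<infinity>"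
        if "s \<in> finite_levels T E P_I P_O C A (t - 1)" for s
        using that by (simp add: finite_levels_def flip: V_eq[OF t P])
    qed
  qed
qed

end
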